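(* Let $\widehat{F}_3$ be the rainbow triangle (a $3$-coloring of $K_3$ whose three edges have three different colors). Then: (a) For every $\delta>0$ there exists $n_0$ such that every graph $G$ of order $n>n_0$ satisfies $c_{3,\widehat{F}_3}(G)\le 2^{(1+\delta)n^2/2}$. (b) For every $\xi>0$ there exists $n_1$ such that if $G$ is a graph of order $n>n_1$ with $c_{3,\widehat{F}_3}(G)\ge 2^{\binom{n}{2}}$, then $|E(G)|\ge\binom{n}{2}-\xi n^2$.
   Context: A $3$-coloring of a graph assigns one of three colors to each edge (not necessarily properly). $c_{3,\widehat{F}_3}(G)$ denotes the number of $3$-colorings of the edges of $G$ containing no triangle whose three edges have three distinct colors. *)

theory Defs
  imports Complex_Main "HOL-Library.FuncSet"
begin

definition simple_graph :: "'a set \<Rightarrow> 'a set set \<Rightarrow> bool" where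
  "simple_graph V E \<longleftrightarrow> finite V \<and>
     E \<subseteq> {e. \<exists>u v. u \<in> V \<and> v \<in> V \<and> u \<noteq> v \<and> e = {u, v}}"

definition edge_3_colorings :: "'a set set \<Rightarrow> ('a set \<Rightarrow> nat) set" where
  "edge_3_colorings E = E \<rightarrow>\<^sub>E {0..<3}"

definition has_rainbow_triangle :: "'a set set \<Rightarrow> ('a set \<Rightarrow> nat) \<Rightarrow> bool" where
  "has_rainbow_triangle E c \<longleftrightarrow>
     (\<exists>u v w. u \<noteq> v \<and> v \<noteq> w \<and> u \<noteq> w \<and>
        {u, v} \<in> E \<and> {v, w} \<in> E \<and> {u, w} \<in> E \<and>
        c {u, v} \<noteq> c {v, w} \<and> c {v, w} \<noteq> c {u, w} \<and> c {u, v} \<noteq> c {u, w})"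

definition c3_rainbow :: "'a set \<Rightarrow> 'a set set \<Rightarrow> nat" where
  "c3_rainbow V E = card {c \<in> edge_3_colorings E. \<not> has_rainbow_triangle E c}"

end

theory Submission
  imports Defs "HOL-Real_Asymp.Real_Asymp"
begin

text \<open>
  Call \<open>w\<close> a witness for the edge \<open>uv\<close> in a rainbow-free coloring if \<open>uw\<close> and \<open>vw\<close> have
  different colors; a witness leaves only two possible colors for \<open>uv\<close>. Either some edge \<open>uv\<close> has
  at most \<open>n/40\<close> witnesses, and then almost every other vertex sees \<open>u\<close> and \<open>v\<close> in the same color:
  given the coloring of \<open>G - u - v\<close> there are only \<open>O((7/2)^n)\<close> such colorings, which is exponentially
  less than the \<open>2^(2n - 2)\<close> by which the claimed bound grows. Or every edge has many witnesses, and
  then a set \<open>S\<close> of \<open>o(n^2)/n\<close> vertices contains a witness for each of them: the coloring of the \<open>o(n^2)\<close>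
  edges touching \<open>S\<close> leaves at most two colors for every other edge. Induction on \<open>n\<close> gives a bound
  \<open>2^((1 - \<gamma> + \<epsilon>) n^2/2 + \<gamma> |E|)\<close> with the slack \<open>\<gamma> = 1/20\<close> between \<open>7/2\<close> and \<open>4\<close>, and both
  parts follow from it.
\<close>

section \<open>Rainbow-free colorings (Gallai colorings) and witnesses\<close>

definition gallai_colorings :: "'a set set \<Rightarrow> ('a set \<Rightarrow> nat) set" where
  "gallai_colorings E = {c \<in> edge_3_colorings E. \<not> has_rainbow_triangle E c}"

definition witnesses :: "'a set \<Rightarrow> 'a set set \<Rightarrow> ('a set \<Rightarrow> nat) \<Rightarrow> 'a \<Rightarrow> 'a \<Rightarrow> 'a set" where
  "witnesses V E c u v = {w \<in> V. {u, w} \<in> E \<and> {v, w} \<in> E \<and> c {u, w} \<noteq> c {v, w}}"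

lemma c3_rainbow_eq: "c3_rainbow V E = card (gallai_colorings E)"
  by (simp add: c3_rainbow_def gallai_colorings_def)

lemma simple_graph_finite:
  assumes "simple_graph V E" shows "finite V" "finite E"
proof -
  show "finite V" using assms by (simp add: simple_graph_def)
  moreover have "E \<subseteq> Pow V" using assms by (auto simp: simple_graph_def)
  ultimately show "finite E" by (meson finite_Pow_iff finite_subset)
qed

lemma simple_graph_edge:
  assumes "simple_graph V E" "e \<in> E"
  obtains u v where "u \<in> V" "v \<in> V" "u \<noteq> v" "e = {u, v}"
  using assms unfolding simple_graph_def by blast

lemma simple_graph_no_loop:
  assumes "simple_graph V E" shows "{u} \<notin> E" "{u, u} \<notin> E"
  using assms unfolding simple_graph_def by auto

lemma finite_gallai_colorings:
  assumes "finite E" shows "finite (gallai_colorings E)"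
  using assms by (simp add: gallai_colorings_def edge_3_colorings_def finite_PiE)

lemma restrict_gallai_coloring:
  assumes "c \<in> gallai_colorings E" "E' \<subseteq> E"
  shows "restrict c E' \<in> gallai_colorings E'"
proof -
  have "has_rainbow_triangle E c" if "has_rainbow_triangle E' (restrict c E')"
    using that subsetD[OF assms(2)] unfolding has_rainbow_triangle_def
    by (elim exE conjE, intro exI conjI) auto
  then show ?thesis
    using assms by (auto simp: gallai_colorings_def edge_3_colorings_def)
qed

section \<open>Bounds on the number of edges\<close>

lemma card_edges_le_choose:
  assumes "simple_graph V E" shows "card E \<le> card V choose 2"
proof -
  have "E \<subseteq> {e. e \<subseteq> V \<and> card e = 2}"
    using assms unfolding simple_graph_def by auto
  moreover have "finite {e. e \<subseteq> V \<and> card e = 2}"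
    using simple_graph_finite[OF assms] by simp
  ultimately have "card E \<le> card {e. e \<subseteq> V \<and> card e = 2}"
    by (rule card_mono[rotated])
  then show ?thesis
    using simple_graph_finite[OF assms] by (simp add: n_subsets)
qed

lemma real_choose_two: "real (n choose 2) = real n * (real n - 1) / 2"
proof -
  have "2 * (n choose 2) = n * (n - 1)"
    by (cases n) (auto simp: choose_two)
  then have "2 * real (n choose 2) = real (n * (n - 1))"
    by (metis of_nat_mult of_nat_numeral)
  then show ?thesis by (cases n) (auto simp: field_simps)
qed

lemma card_edges_le:
  assumes "simple_graph V E" shows "real (card E) \<le> real (card V) ^ 2 / 2"
proof -
  have "real (card E) \<le> real (card V choose 2)"
    using card_edges_le_choose[OF assms] by simp
  also have "\<dots> \<le> real (card V) ^ 2 / 2"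
    by (simp add: real_choose_two power2_eq_square field_simps)
  finally show ?thesis .
qed

section \<open>Greedy hitting sets\<close>

text \<open>Greedy choice: some vertex lies in at least a proportion \<open>q\<close> of the sets
  not yet hit, and adding it to \<open>S\<close> leaves at most a proportion \<open>1 - q\<close> of
  them.\<close>

lemma hitting_set:
  fixes A :: "'i \<Rightarrow> 'v set" and q :: real
  assumes fin: "finite I" "finite V" and ne: "V \<noteq> {}" and sub: "\<And>i. i \<in> I \<Longrightarrow> A i \<subseteq> V"
    and big: "\<And>i. i \<in> I \<Longrightarrow> q * card V \<le> card (A i)" and q: "q \<le> 1"
  shows "\<exists>S\<subseteq>V. card S \<le> s \<and> real (card {i \<in> I. A i \<inter> S = {}}) \<le> (1 - q) ^ s * card I"
proof (induction s)
  case 0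
  show ?case by (intro exI[of _ "{}"]) auto
next
  case (Suc s)
  then obtain S where S: "S \<subseteq> V" "card S \<le> s"
    and le: "real (card {i \<in> I. A i \<inter> S = {}}) \<le> (1 - q) ^ s * card I" by blast
  define J where "J = {i \<in> I. A i \<inter> S = {}}"
  have J: "finite J" "J \<subseteq> I" using fin by (auto simp: J_def)
  \<comment> \<open>Double counting of the incidences between \<open>V\<close> and \<open>J\<close>:
    each set contributes at least \<open>q * card V\<close>, so an average vertex lies in at least
    \<open>q * card J\<close> sets.\<close>
  have "\<exists>v\<in>V. q * card J \<le> card {i \<in> J. v \<in> A i}"
  proof (rule ccontr)
    assume "\<not> ?thesis"
    then have lt: "card {i \<in> J. v \<in> A i} < q * card J" if "v \<in> V" for v
      using that by force
    have "(\<Sum>v\<in>V. real (card {i \<in> J. v \<in> A i})) < (\<Sum>v\<in>V. q * card J)"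
      using lt ne fin by (intro sum_strict_mono) auto
    also have "\<dots> = (\<Sum>i\<in>J. q * card V)" by simp
    also have "\<dots> \<le> (\<Sum>i\<in>J. real (card (A i)))"
      using big J by (intro sum_mono) auto
    also have "\<dots> = (\<Sum>i\<in>J. \<Sum>v\<in>V. of_bool (v \<in> A i))"
    proof (rule sum.cong)
      fix i assume "i \<in> J"
      then have "V \<inter> {v. v \<in> A i} = A i" using sub J by auto
      then show "real (card (A i)) = (\<Sum>v\<in>V. of_bool (v \<in> A i))"
        using fin by simp
    qed simp
    also have "\<dots> = (\<Sum>v\<in>V. \<Sum>i\<in>J. of_bool (v \<in> A i))" by (rule sum.swap)
    also have "\<dots> = (\<Sum>v\<in>V. real (card {i \<in> J. v \<in> A i}))"
      using J by (simp add: Collect_conj_eq)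
    finally show False by simp
  qed
  then obtain v where v: "v \<in> V" "q * card J \<le> card {i \<in> J. v \<in> A i}" by blast
  have "{i \<in> I. A i \<inter> insert v S = {}} = J - {i \<in> J. v \<in> A i}" by (auto simp: J_def)
  then have "real (card {i \<in> I. A i \<inter> insert v S = {}}) = card J - card {i \<in> J. v \<in> A i}"
    using J by (simp add: card_Diff_subset card_mono)
  also have "\<dots> = real (card J) - card {i \<in> J. v \<in> A i}"
    using J by (intro of_nat_diff card_mono) auto
  also have "\<dots> \<le> (1 - q) * card J" using v by (simp add: algebra_simps)
  also have "\<dots> \<le> (1 - q) * ((1 - q) ^ s * card I)"
    using le q by (intro mult_left_mono) (auto simp: J_def)
  finally have "real (card {i \<in> I. A i \<inter> insert v S = {}}) \<le> (1 - q) ^ Suc s * card I"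
    by (simp add: mult.assoc)
  moreover have "card (insert v S) \<le> Suc s" "insert v S \<subseteq> V"
    using S v card_insert_le_m1[of "Suc s" S v] by auto
  ultimately show ?case by blast
qed

lemma card_le_fibres:
  assumes "finite X" "\<And>y. y \<in> f ` X \<Longrightarrow> card {x \<in> X. f x = y} \<le> b"
  shows "card X \<le> card (f ` X) * b"
proof -
  have "card X = (\<Sum>x\<in>X. 1)" by simp
  also have "\<dots> = (\<Sum>y\<in>f ` X. \<Sum>x\<in>{x \<in> X. f x = y}. 1)"
    using assms(1) by (rule sum.image_gen)
  also have "\<dots> \<le> (\<Sum>y\<in>f ` X. b)"
    using assms(2) by (intro sum_mono) auto
  finally show ?thesis by simp
qed

section \<open>Colorings in which a given edge has few witnesses\<close>

lemma card_mostly_equal_pairs: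
  assumes "finite W" "card W \<le> n"
  shows "real (card {g \<in> W \<rightarrow>\<^sub>E ({0..<3::nat} \<times> {0..<3::nat}).
           40 * card {w \<in> W. fst (g w) \<noteq> snd (g w)} \<le> n}) \<le> (7/2) ^ n"
proof -
  \<comment> \<open>Exponential moment bound: unequal pairs get weight \<open>1/30\<close>, which suits since
    \<open>30 \<le> (35/32)^40\<close> and \<open>(35/32) * (3 + 6/30) = 7/2\<close>.\<close>
  define f :: "nat \<times> nat \<Rightarrow> real" where "f p = (if fst p \<noteq> snd p then 1/30 else 1)" for p
  let ?P = "W \<rightarrow>\<^sub>E ({0..<3::nat} \<times> {0..<3::nat})"
  let ?G = "{g \<in> ?P. 40 * card {w \<in> W. fst (g w) \<noteq> snd (g w)} \<le> n}"
  have finP: "finite ?P" using assms by (intro finite_PiE) auto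
  have f0: "0 \<le> f p" for p by (simp add: f_def)
  have weight: "1 \<le> (35/32) ^ n * (\<Prod>w\<in>W. f (g w))" if "g \<in> ?G" for g
  proof -
    define k where "k = card {w \<in> W. fst (g w) \<noteq> snd (g w)}"
    have k: "40 * k \<le> n" using that by (simp add: k_def)
    have "(\<Prod>w\<in>W. f (g w)) = (1/30) ^ k"
      using assms by (simp add: f_def k_def prod.If_cases Int_def)
    moreover have "(30::real) ^ k \<le> ((35/32) ^ 40) ^ k"
      by (intro power_mono) (simp_all add: field_simps)
    moreover have "((35/32::real) ^ 40) ^ k \<le> (35/32) ^ n"
      unfolding power_mult[symmetric] using k by (intro power_increasing) auto
    ultimately have "1 = 30 ^ k * (\<Prod>w\<in>W. f (g w))" "(30::real) ^ k \<le> (35/32) ^ n"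
      by (simp add: power_one_over, linarith)
    then show ?thesis using f0 by (metis mult_right_mono prod_nonneg)
  qed
  have "real (card ?G) = (\<Sum>g\<in>?G. 1)" by simp
  also have "\<dots> \<le> (\<Sum>g\<in>?G. (35/32) ^ n * (\<Prod>w\<in>W. f (g w)))"
    using weight by (intro sum_mono) auto
  also have "\<dots> \<le> (\<Sum>g\<in>?P. (35/32) ^ n * (\<Prod>w\<in>W. f (g w)))"
    using finP by (intro sum_mono2) (auto intro!: mult_nonneg_nonneg prod_nonneg f0)
  also have "\<dots> = (35/32) ^ n * (\<Prod>w\<in>W. \<Sum>p\<in>{0..<3} \<times> {0..<3}. f p)"
    using assms by (subst prod_sum_PiE) (auto simp: sum_distrib_left)
  also have "(\<Sum>p\<in>{0..<3} \<times> {0..<3}. f p) = 16/5"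
    by (simp add: sum.cartesian_product' f_def numeral_3_eq_3)
  also have "(35/32) ^ n * (\<Prod>w\<in>W. 16/5) \<le> (35/32) ^ n * (16/5::real) ^ n"
    using assms by (simp add: power_increasing)
  also have "\<dots> = (7/2) ^ n" by (simp flip: power_mult_distrib)
  finally show ?thesis .
qed

text \<open>A coloring is determined by its restriction to the edges avoiding \<open>u\<close> and
  \<open>v\<close>, the color of \<open>{u, v}\<close>, and for each other vertex the pair of its
  colors towards \<open>u\<close> and \<open>v\<close>. The second entry gives the factor 3; the
  pairs are mostly equal, which gives \<open>(7/2) ^ card V\<close>.\<close>

lemma card_gallai_few_witnesses:
  assumes G: "simple_graph V E" and uv: "u \<in> V" "v \<in> V" "u \<noteq> v"
  shows "real (card {c \<in> gallai_colorings E. 40 * card (witnesses V E c u v) \<le> card V})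
    \<le> 3 * (7/2) ^ card V * real (c3_rainbow (V - {u, v}) {e \<in> E. u \<notin> e \<and> v \<notin> e})"
proof -
  let ?X = "{c \<in> gallai_colorings E. 40 * card (witnesses V E c u v) \<le> card V}"
  define W where "W = V - {u, v}"
  define E' where "E' = {e \<in> E. u \<notin> e \<and> v \<notin> e}"
  let ?G = "{g \<in> W \<rightarrow>\<^sub>E ({0..<3::nat} \<times> {0..<3::nat}).
           40 * card {w \<in> W. fst (g w) \<noteq> snd (g w)} \<le> card V}"
  \<comment> \<open>A missing edge copies the color of its partner, so that the unequal pairs
    are exactly the witnesses.\<close>
  define a where "a c w = (if {u, w} \<in> E then c {u, w} else if {v, w} \<in> E then c {v, w} else (0::nat))"
    for c w
  define b where "b c w = (if {v, w} \<in> E then c {v, w} else a c w)" for c w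
  \<comment> \<open>The default 0 for an absent edge keeps this entry among the three
    colors.\<close>
  define h where "h c = (if {u, v} \<in> E then c {u, v} else (0::nat))" for c
  define \<Phi> where "\<Phi> c = (restrict c E', h c, restrict (\<lambda>w. (a c w, b c w)) W)" for c
  note fin = simple_graph_finite[OF G]
  have col: "c e < 3" if "c \<in> ?X" "e \<in> E" for c e
    using that by (auto simp: gallai_colorings_def edge_3_colorings_def)
  \<comment> \<open>There are no loops, so \<open>u\<close> and \<open>v\<close> are never witnesses
    themselves and passing to \<open>W\<close> loses none.\<close>
  have wit: "{w \<in> W. a c w \<noteq> b c w} = witnesses V E c u v" for c
    using simple_graph_no_loop[OF G] uv
    by (auto simp: a_def b_def W_def witnesses_def insert_commute split: if_splits)
  have "inj_on \<Phi> ?X"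
  proof (rule inj_onI)
    fix c c' assume c: "c \<in> ?X" and c': "c' \<in> ?X" and eq: "\<Phi> c = \<Phi> c'"
    have "restrict c E' = restrict c' E'" using eq by (simp add: \<Phi>_def)
    then have "restrict c E' e = restrict c' E' e" for e by (rule fun_cong)
    then have E'eq: "c e = c' e" if "e \<in> E'" for e
      unfolding restrict_def using that by presburger
    have heq: "h c = h c'" using eq by (simp add: \<Phi>_def)
    have "restrict (\<lambda>w. (a c w, b c w)) W = restrict (\<lambda>w. (a c' w, b c' w)) W"
      using eq by (simp add: \<Phi>_def)
    then have "restrict (\<lambda>w. (a c w, b c w)) W w = restrict (\<lambda>w. (a c' w, b c' w)) W w" for w
      by (rule fun_cong)
    then have abeq: "a c w = a c' w \<and> b c w = b c' w" if "w \<in> W" for w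
      unfolding restrict_def using that by (metis prod.inject)
    \<comment> \<open>Copying only fills in absent edges, so \<open>a\<close> and \<open>b\<close>
      return the color of every edge present between \<open>W\<close> and \<open>u\<close> or
      \<open>v\<close>.\<close>
    have ueq: "c {u, w} = c' {u, w}" if "w \<in> W" "{u, w} \<in> E" for w
      using abeq[OF that(1)] that(2) by (simp add: a_def)
    have veq: "c {v, w} = c' {v, w}" if "w \<in> W" "{v, w} \<in> E" for w
      using abeq[OF that(1)] that(2) by (simp add: b_def)
    have "c e = c' e" if e: "e \<in> E" for e
    proof -
      obtain x y where xy: "x \<in> V" "y \<in> V" "x \<noteq> y" "e = {x, y}"
        using simple_graph_edge[OF G e] .
      have outside: "z = u \<or> z = v" if "z \<in> V" "z \<notin> W" for z
        using that by (auto simp: W_def)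
      consider "x \<in> W" "y \<in> W" | "x \<notin> W" "y \<notin> W" | "x \<in> W" "y \<notin> W" | "x \<notin> W" "y \<in> W"
        by blast
      then show ?thesis
      proof cases
        case 1
        then have "e \<in> E'" using e xy by (auto simp: E'_def W_def)
        then show ?thesis by (rule E'eq)
      next
        case 2
        then have "e = {u, v}" using outside xy by blast
        then show ?thesis using heq e by (simp add: h_def)
      next
        case 3
        then have "e = {u, x} \<or> e = {v, x}" using outside xy by blast
        then show ?thesis using 3 ueq veq e by metis
      next
        case 4
        then have "e = {u, y} \<or> e = {v, y}" using outside xy by blast
        then show ?thesis using 4 ueq veq e by metis
      qed
    qed
    then show "c = c'"
      using c c' unfolding gallai_colorings_def edge_3_colorings_def by (blast intro: PiE_ext)
  qed
  moreover have "\<Phi> ` ?X \<subseteq> gallai_colorings E' \<times> {0..<3} \<times> ?G"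
  proof
    fix y assume "y \<in> \<Phi> ` ?X"
    then obtain c where c: "c \<in> ?X" and y: "y = \<Phi> c" by blast
    have "restrict c E' \<in> gallai_colorings E'"
      using c by (intro restrict_gallai_coloring[of _ E]) (auto simp: E'_def)
    moreover have "h c < 3" using col[OF c] by (auto simp: h_def)
    moreover have "a c w < 3" "b c w < 3" for w
      using col[OF c] by (auto simp: a_def b_def)
    moreover have "{w \<in> W. fst (restrict (\<lambda>w. (a c w, b c w)) W w) \<noteq> snd (restrict (\<lambda>w. (a c w, b c w)) W w)}
        = witnesses V E c u v"
      unfolding wit[of c, symmetric] by auto
    ultimately show "y \<in> gallai_colorings E' \<times> {0..<3} \<times> ?G"
      using c by (auto simp: y \<Phi>_def)
  qed
  moreover have finG: "finite ?G"
    using fin by (intro finite_subset[OF _ finite_PiE[of W "\<lambda>_. {0..<3} \<times> {0..<3}"]]) (auto simp: W_def)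
  moreover have "finite (gallai_colorings E')"
    using fin by (intro finite_gallai_colorings) (simp add: E'_def)
  ultimately have "card ?X \<le> card (gallai_colorings E' \<times> {0..<3::nat} \<times> ?G)"
    by (intro card_inj_on_le[of \<Phi>]) auto
  also have "\<dots> = card (gallai_colorings E') * 3 * card ?G"
    by (simp add: card_cartesian_product)
  finally have "real (card ?X) \<le> real (card (gallai_colorings E') * 3 * card ?G)"
    by (rule of_nat_mono)
  also have "\<dots> = real (card (gallai_colorings E') * 3) * real (card ?G)"
    by (rule of_nat_mult)
  also have "\<dots> \<le> real (card (gallai_colorings E') * 3) * (7/2) ^ card V"
  proof (rule mult_left_mono)
    have "finite W" "card W \<le> card V" using fin by (auto simp: W_def intro: card_mono)
    then show "real (card ?G) \<le> (7/2) ^ card V" by (rule card_mostly_equal_pairs)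
  qed simp
  finally show ?thesis by (simp add: c3_rainbow_eq E'_def W_def mult_ac)
qed

section \<open>Colorings whose witness sets are all hit by one vertex set\<close>

text \<open>There are at most \<open>3 ^ (card S * card V)\<close> ways to color the edges touching
  \<open>S\<close>. A witness in \<open>S\<close> for \<open>{u, v}\<close> has both its edges to
  \<open>u\<close> and \<open>v\<close> among these; as no triangle is rainbow,
  \<open>{u, v}\<close> must take one of their two colors.\<close>

lemma card_gallai_hitting_set:
  assumes G: "simple_graph V E" and S: "S \<subseteq> V"
  shows "card {c \<in> gallai_colorings E. \<forall>u v. {u, v} \<in> E \<longrightarrow> witnesses V E c u v \<inter> S \<noteq> {}}
    \<le> 3 ^ (card S * card V) * 2 ^ card E"
proof -
  let ?X = "{c \<in> gallai_colorings E. \<forall>u v. {u, v} \<in> E \<longrightarrow> witnesses V E c u v \<inter> S \<noteq> {}}"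
  define F where "F = {e \<in> E. e \<inter> S \<noteq> {}}"
  define f where "f c = restrict c F" for c :: "'a set \<Rightarrow> nat"
  note fin = simple_graph_finite[OF G]
  have finX: "finite ?X" using finite_gallai_colorings[OF fin(2)] by simp
  have finS: "finite S" using S fin by (meson finite_subset)
  have finF: "finite F" using fin by (simp add: F_def)
  have "F \<subseteq> (\<lambda>(x, y). {x, y}) ` (S \<times> V)"
  proof
    fix e assume e: "e \<in> F"
    then obtain x y where "x \<in> V" "y \<in> V" "e = {x, y}"
      using simple_graph_edge[OF G] unfolding F_def by blast
    then show "e \<in> (\<lambda>(x, y). {x, y}) ` (S \<times> V)"
      using e by (auto simp: F_def insert_commute image_iff)
  qed
  then have "card F \<le> card (S \<times> V)"
    using fin finS by (intro surj_card_le) auto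
  then have cardF: "card F \<le> card S * card V" by (simp add: card_cartesian_product)
  have fibre: "card {c \<in> ?X. f c = r} \<le> 2 ^ card E" if "r \<in> f ` ?X" for r
  proof -
    \<comment> \<open>One representative \<open>c0\<close> supplies the witnesses for the whole
      fibre: the edges at a witness in \<open>S\<close> lie in \<open>F\<close>, where all members
      agree, so the two admissible colors of an edge are the same for every member.\<close>
    obtain c0 where c0: "c0 \<in> ?X" and r: "r = f c0" using \<open>r \<in> f ` ?X\<close> by blast
    have agree: "c e = c0 e" if "c \<in> ?X" "f c = r" "e \<in> F" for c e
      using that r unfolding f_def by (metis restrict_apply')
    define Q where "Q e B \<longleftrightarrow> finite B \<and> card B \<le> 2 \<and> (\<forall>c\<in>{c \<in> ?X. f c = r}. c e \<in> B)"
      for e B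
    have "\<forall>e\<in>E. \<exists>B. Q e B"
    proof
      fix e assume e: "e \<in> E"
      obtain u v where uv: "u \<in> V" "v \<in> V" "u \<noteq> v" "e = {u, v}"
        using simple_graph_edge[OF G e] .
      then obtain w where w: "w \<in> witnesses V E c0 u v" "w \<in> S" using c0 e by blast
      have wE: "{u, w} \<in> F" "{v, w} \<in> F" and ne: "c0 {u, w} \<noteq> c0 {v, w}"
        using w by (auto simp: witnesses_def F_def)
      have "u \<noteq> w" "v \<noteq> w"
        using wE simple_graph_no_loop[OF G] by (auto simp: F_def)
      have "c e \<in> {c0 {u, w}, c0 {v, w}}" if c: "c \<in> ?X" "f c = r" for c
      proof (rule ccontr)
        assume "c e \<notin> {c0 {u, w}, c0 {v, w}}"
        then have "has_rainbow_triangle E c"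
          unfolding has_rainbow_triangle_def
          using agree[OF c wE(1)] agree[OF c wE(2)] ne uv e wE \<open>u \<noteq> w\<close> \<open>v \<noteq> w\<close>
          by (intro exI[of _ u] exI[of _ v] exI[of _ w]) (simp add: F_def)
        then show False using c by (simp add: gallai_colorings_def)
      qed
      then show "\<exists>B. Q e B"
        unfolding Q_def using ne by (intro exI[of _ "{c0 {u, w}, c0 {v, w}}"]) auto
    qed
    then obtain B where "\<And>e. e \<in> E \<Longrightarrow> Q e (B e)" by metis
    then have B: "finite (B e)" "card (B e) \<le> 2" "\<And>c. c \<in> {c \<in> ?X. f c = r} \<Longrightarrow> c e \<in> B e"
      if "e \<in> E" for e
      using that unfolding Q_def by blast+
    have "{c \<in> ?X. f c = r} \<subseteq> PiE E B"
      using B by (auto simp: gallai_colorings_def edge_3_colorings_def PiE_def)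
    then have "card {c \<in> ?X. f c = r} \<le> card (PiE E B)"
      using B fin by (intro card_mono finite_PiE) auto
    also have "\<dots> = (\<Prod>e\<in>E. card (B e))" using fin by (simp add: card_PiE)
    also have "\<dots> \<le> (\<Prod>e\<in>E. 2)" using B by (intro prod_mono) auto
    finally show ?thesis by simp
  qed
  have "f ` ?X \<subseteq> F \<rightarrow>\<^sub>E {0..<3}"
    by (intro image_subsetI) (auto simp: f_def F_def gallai_colorings_def edge_3_colorings_def restrict_PiE_iff)
  then have "card (f ` ?X) \<le> card (F \<rightarrow>\<^sub>E {0..<3::nat})"
    using finF by (intro card_mono finite_PiE) auto
  also have "\<dots> = 3 ^ card F" using finF by (simp add: card_PiE)
  also have "\<dots> \<le> 3 ^ (card S * card V)" using cardF by (intro power_increasing) auto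
  finally have "card (f ` ?X) * 2 ^ card E \<le> 3 ^ (card S * card V) * 2 ^ card E" by simp
  with card_le_fibres[OF finX fibre] show ?thesis by (rule order_trans)
qed

section \<open>The recurrence\<close>

text \<open>Two union bounds: over at most \<open>card V ^ 2\<close> ordered pairs if some edge has
  at most \<open>card V / 40\<close> witnesses, and over at most \<open>2 ^ card V\<close> hitting
  sets otherwise. The condition on \<open>s\<close> ensures that \<open>s\<close> greedy choices
  leave no witness set unhit.\<close>

lemma c3_rainbow_recurrence:
  assumes G: "simple_graph V E" and ne: "V \<noteq> {}"
    and s: "real (card V) ^ 2 * (39/40) ^ s < 1"
    and M: "\<And>u v. u \<in> V \<Longrightarrow> v \<in> V \<Longrightarrow> u \<noteq> v \<Longrightarrow>
      real (c3_rainbow (V - {u, v}) {e \<in> E. u \<notin> e \<and> v \<notin> e}) \<le> M" and M0: "0 \<le> M"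
  shows "real (c3_rainbow V E) \<le> real (card V) ^ 2 * 3 * (7/2) ^ card V * M
    + 2 ^ card V * 3 ^ (s * card V) * 2 ^ card E"
proof -
  define P where "P = {(u, v). u \<in> V \<and> v \<in> V \<and> {u, v} \<in> E}"
  define few where "few = (\<lambda>(u, v). {c \<in> gallai_colorings E. 40 * card (witnesses V E c u v) \<le> card V})"
  define hit where "hit S = {c \<in> gallai_colorings E. \<forall>u v. {u, v} \<in> E \<longrightarrow> witnesses V E c u v \<inter> S \<noteq> {}}"
    for S
  define \<S> where "\<S> = {S. S \<subseteq> V \<and> card S \<le> s}"
  note fin = simple_graph_finite[OF G]
  have PV: "P \<subseteq> V \<times> V" by (auto simp: P_def)
  have finP: "finite P" using fin by (intro finite_subset[OF PV]) auto
  have "card P \<le> card (V \<times> V)" using fin by (intro card_mono PV) auto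
  then have cardP: "real (card P) \<le> real (card V) ^ 2"
    unfolding card_cartesian_product power2_eq_square by (metis of_nat_mono of_nat_mult)
  have \<S>V: "\<S> \<subseteq> Pow V" by (auto simp: \<S>_def)
  have fin\<S>: "finite \<S>" using fin by (intro finite_subset[OF \<S>V]) auto
  \<comment> \<open>Counting all subsets is affordable: it adds only a linear term to an exponent of
    quadratic order.\<close>
  have "card \<S> \<le> card (Pow V)" using fin by (intro card_mono \<S>V) auto
  then have card\<S>: "card \<S> \<le> 2 ^ card V" using fin by (simp add: card_Pow)
  have cover: "gallai_colorings E \<subseteq> (\<Union>p\<in>P. few p) \<union> (\<Union>S\<in>\<S>. hit S)"
  proof
    fix c assume c: "c \<in> gallai_colorings E"
    show "c \<in> (\<Union>p\<in>P. few p) \<union> (\<Union>S\<in>\<S>. hit S)"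
    proof (cases "c \<in> (\<Union>p\<in>P. few p)")
      case False
      define A where "A = (\<lambda>(u, v). witnesses V E c u v)"
      \<comment> \<open>Outside every \<open>few p\<close>, each witness set has more than
        \<open>card V / 40\<close> elements; this is the source of the ratio
        \<open>39/40\<close>.\<close>
      have "(1/40) * real (card V) \<le> card (A p)" if "p \<in> P" for p
        using False c that by (force simp: few_def A_def)
      moreover have "A p \<subseteq> V" for p by (auto simp: A_def witnesses_def split: prod.splits)
      ultimately obtain S where S: "S \<subseteq> V" "card S \<le> s"
        "real (card {p \<in> P. A p \<inter> S = {}}) \<le> (1 - 1/40) ^ s * card P"
        using hitting_set[OF finP fin(1) ne, of A "1/40" s] by auto
      have "(1 - 1/40) ^ s * real (card P) \<le> (39/40) ^ s * real (card V) ^ 2"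
        using cardP by (intro mult_mono) auto
      also have "\<dots> < 1" using s by (simp add: mult.commute)
      \<comment> \<open>A natural number below 1 is 0.\<close>
      finally have "card {p \<in> P. A p \<inter> S = {}} = 0" using S by linarith
      then have "{p \<in> P. A p \<inter> S = {}} = {}" using finP by (subst (asm) card_0_eq) auto
      then have hits: "A p \<inter> S \<noteq> {}" if "p \<in> P" for p using that by blast
      have "c \<in> hit S"
      proof -
        have "witnesses V E c u v \<inter> S \<noteq> {}" if "{u, v} \<in> E" for u v
        proof -
          have "(u, v) \<in> P" using G that by (auto simp: P_def simple_graph_def doubleton_eq_iff)
          from hits[OF this] show ?thesis by (simp add: A_def)
        qed
        then show ?thesis using c by (simp add: hit_def)
      qed
      then show ?thesis using S by (auto simp: \<S>_def)
    qed simp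
  qed
  have fing: "finite (gallai_colorings E)" using finite_gallai_colorings[OF fin(2)] .
  have finfew: "finite (few p)" for p using fing by (auto simp: few_def split: prod.splits)
  have finhit: "finite (hit S)" for S using fing by (auto simp: hit_def)
  have few_le: "real (card (few p)) \<le> 3 * (7/2) ^ card V * M" if pP: "p \<in> P" for p
  proof -
    obtain u v where p: "p = (u, v)" "u \<in> V" "v \<in> V" "{u, v} \<in> E"
      using pP by (auto simp: P_def)
    then have "u \<noteq> v" using simple_graph_no_loop[OF G] by auto
    have "real (card (few p)) \<le> 3 * (7/2) ^ card V * real (c3_rainbow (V - {u, v}) {e \<in> E. u \<notin> e \<and> v \<notin> e})"
      using card_gallai_few_witnesses[OF G p(2,3) \<open>u \<noteq> v\<close>] by (simp add: few_def p)
    also have "\<dots> \<le> 3 * (7/2) ^ card V * M"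
      using M[OF p(2,3) \<open>u \<noteq> v\<close>] by (intro mult_left_mono) auto
    finally show ?thesis .
  qed
  have hit_le: "card (hit S) \<le> 3 ^ (s * card V) * 2 ^ card E" if "S \<in> \<S>" for S
  proof -
    have S: "S \<subseteq> V" "card S \<le> s" using that by (auto simp: \<S>_def)
    have "card (hit S) \<le> 3 ^ (card S * card V) * 2 ^ card E"
      unfolding hit_def by (rule card_gallai_hitting_set[OF G S(1)])
    also have "\<dots> \<le> 3 ^ (s * card V) * 2 ^ card E"
      using S by (intro mult_right_mono power_increasing) auto
    finally show ?thesis .
  qed
  have "card (gallai_colorings E) \<le> card ((\<Union>p\<in>P. few p) \<union> (\<Union>S\<in>\<S>. hit S))"
    using cover finP fin\<S> finfew finhit by (intro card_mono) auto
  also have "\<dots> \<le> card (\<Union>p\<in>P. few p) + card (\<Union>S\<in>\<S>. hit S)" by (rule card_Un_le)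
  also have "\<dots> \<le> (\<Sum>p\<in>P. card (few p)) + (\<Sum>S\<in>\<S>. card (hit S))"
    using finP fin\<S> by (intro add_mono card_UN_le)
  also have "\<dots> \<le> (\<Sum>p\<in>P. card (few p)) + (\<Sum>S\<in>\<S>. 3 ^ (s * card V) * 2 ^ card E)"
    using hit_le by (intro add_left_mono sum_mono)
  also have "\<dots> \<le> (\<Sum>p\<in>P. card (few p)) + 2 ^ card V * (3 ^ (s * card V) * 2 ^ card E)"
    using card\<S> by simp
  finally have "real (c3_rainbow V E) \<le>
      real ((\<Sum>p\<in>P. card (few p)) + 2 ^ card V * (3 ^ (s * card V) * 2 ^ card E))"
    unfolding c3_rainbow_eq by (rule of_nat_mono)
  also have "\<dots> = (\<Sum>p\<in>P. real (card (few p))) + 2 ^ card V * 3 ^ (s * card V) * 2 ^ card E"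
    by simp
  also have "(\<Sum>p\<in>P. real (card (few p))) \<le> (\<Sum>p\<in>P. 3 * (7/2) ^ card V * M)"
    using few_le by (intro sum_mono)
  also have "\<dots> = real (card P) * (3 * (7/2) ^ card V * M)" by simp
  also have "\<dots> \<le> real (card V) ^ 2 * (3 * (7/2) ^ card V * M)"
    using cardP M0 by (intro mult_right_mono) auto
  finally show ?thesis by (simp add: mult.assoc)
qed

section \<open>Asymptotic comparisons for the induction\<close>

text \<open>Serves the condition on \<open>s\<close> in the recurrence for \<open>s\<close> the
  integer part of \<open>\<epsilon> * n / 8\<close>, through
  \<open>(39/40) ^ s \<le> exp (- s / 40)\<close>.\<close>

lemma eventually_hitting_size:
  assumes "(\<epsilon>::real) > 0"
  shows "\<forall>\<^sub>F n in sequentially. real n ^ 2 * exp (- (\<epsilon> * real n / 8 - 1) / 40) < 1"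
  using assms by real_asymp

text \<open>The exponent \<open>2 * n - 2\<close> is the drop of \<open>n ^ 2 / 2\<close> when two
  vertices are removed. Since \<open>7/2 \<le> 2 powr (37/20)\<close> and
  \<open>37/20 < 2 * 19/20\<close>, the quadratic factor is absorbed. The \<open>1/2\<close>
  reserves half of the target for the other summand of the recurrence.\<close>

lemma eventually_few_witnesses_factor:
  "\<forall>\<^sub>F n in sequentially. real n ^ 2 * 3 * (7/2) ^ n \<le> 1/2 * 2 powr ((19/20) * (2 * real n - 2))"
proof -
  have "(7/2::real) ^ 20 \<le> 2 ^ 37" by (simp add: power_divide)
  then have "(7/2::real) powr 20 \<le> 2 powr 37" by simp
  then have "((7/2::real) powr 20) powr (1/20) \<le> (2 powr 37) powr (1/20)"
    by (intro powr_mono2) auto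
  then have base: "(7/2::real) \<le> 2 powr (37/20)" unfolding powr_powr by simp
  have "\<forall>\<^sub>F n in sequentially.
      real n ^ 2 * 3 * 2 powr (37/20 * real n) \<le> 1/2 * 2 powr ((19/20) * (2 * real n - 2))"
    by real_asymp
  then show ?thesis
  proof eventually_elim
    case (elim n)
    have "(7/2::real) ^ n \<le> (2 powr (37/20)) ^ n" using base by (intro power_mono) auto
    also have "\<dots> = 2 powr (37/20 * real n)" by (simp add: powr_powr flip: powr_realpow)
    finally show ?case using elim by (smt (verit) mult_left_mono zero_le_power2)
  qed
qed

text \<open>Exponent budget of the second summand: \<open>n\<close> for the choice of
  \<open>S\<close>, \<open>\<epsilon> * n ^ 2 / 4\<close> for the colors of the edges touching
  \<open>S\<close>, and 1 for the factor \<open>1/2\<close>.\<close>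

lemma eventually_lower_order:
  assumes "(\<epsilon>::real) > 0"
  shows "\<forall>\<^sub>F n in sequentially. real n + \<epsilon> * real n ^ 2 / 4 + 1 \<le> \<epsilon> * real n ^ 2 / 2"
  using assms by real_asymp

section \<open>The bound by induction on the number of vertices\<close>

lemma c3_rainbow_le_crude:
  assumes "simple_graph V E" shows "real (c3_rainbow V E) \<le> 3 ^ card E"
proof -
  have "card (gallai_colorings E) \<le> card (E \<rightarrow>\<^sub>E {0..<3::nat})"
    using simple_graph_finite[OF assms]
    by (intro card_mono finite_PiE) (auto simp: gallai_colorings_def edge_3_colorings_def)
  also have "\<dots> = 3 ^ card E" using simple_graph_finite[OF assms] by (simp add: card_PiE)
  finally show ?thesis unfolding c3_rainbow_eq by (metis of_nat_mono of_nat_numeral of_nat_power)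
qed

text \<open>Strong induction removing two vertices, with \<open>K\<close> absorbing the small
  graphs. The weight \<open>19/20\<close> is large enough that \<open>2 powr (2 * 19/20)\<close>
  exceeds \<open>7/2\<close>, yet below 1, so that the edge count stays in the bound.\<close>

theorem c3_rainbow_le:
  fixes \<epsilon> :: real
  assumes "\<epsilon> > 0"
  obtains K :: real where "K \<ge> 1" "\<And>(V :: 'a set) E. simple_graph V E \<Longrightarrow>
    real (c3_rainbow V E) \<le> K * 2 powr ((19/20 + \<epsilon>) * real (card V) ^ 2 / 2 + card E / 20)"
proof -
  have "\<forall>\<^sub>F n in sequentially. real n ^ 2 * exp (- (\<epsilon> * real n / 8 - 1) / 40) < 1 \<and>
     real n ^ 2 * 3 * (7/2) ^ n \<le> 1/2 * 2 powr ((19/20) * (2 * real n - 2)) \<and>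
     real n + \<epsilon> * real n ^ 2 / 4 + 1 \<le> \<epsilon> * real n ^ 2 / 2 \<and> n > 0"
    using assms by (intro eventually_conj eventually_hitting_size eventually_few_witnesses_factor
      eventually_lower_order eventually_gt_at_top)
  then obtain N where N: "\<And>n. n \<ge> N \<Longrightarrow> real n ^ 2 * exp (- (\<epsilon> * real n / 8 - 1) / 40) < 1 \<and>
     real n ^ 2 * 3 * (7/2) ^ n \<le> 1/2 * 2 powr ((19/20) * (2 * real n - 2)) \<and>
     real n + \<epsilon> * real n ^ 2 / 4 + 1 \<le> \<epsilon> * real n ^ 2 / 2 \<and> n > 0"
    unfolding eventually_sequentially by blast
  \<comment> \<open>Graphs with fewer than \<open>N\<close> vertices have at most
    \<open>N ^ 2\<close> edges, so \<open>K\<close> bounds all their colorings.\<close>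
  define K :: real where "K = 3 ^ (N ^ 2)"
  have K: "K \<ge> 1" by (simp add: K_def)
  have "real (c3_rainbow V E) \<le> K * 2 powr ((19/20 + \<epsilon>) * real (card V) ^ 2 / 2 + card E / 20)"
    if "simple_graph V E" for V :: "'a set" and E
    using that
  proof (induction "card V" arbitrary: V E rule: less_induct)
    case less
    note G = less.prems
    define n where "n = card V"
    define e where "e = card E"
    have e: "real e \<le> real n ^ 2 / 2" using card_edges_le[OF G] by (simp add: n_def e_def)
    show ?case
    proof (cases "n < N")
      case True
      have "real n ^ 2 / 2 \<le> real n ^ 2" by simp
      with e have "real e \<le> real (n ^ 2)" unfolding of_nat_power by linarith
      then have "e \<le> n ^ 2" by (simp only: of_nat_le_iff)
      also have "\<dots> \<le> N ^ 2" using True by (intro power_mono) auto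
      finally have "(3::real) ^ e \<le> K" unfolding K_def by (intro power_increasing) auto
      moreover have "1 \<le> 2 powr ((19/20 + \<epsilon>) * real n ^ 2 / 2 + e / 20)"
        using assms by (intro ge_one_powr_ge_zero) auto
      ultimately have "3 ^ e \<le> K * 2 powr ((19/20 + \<epsilon>) * real n ^ 2 / 2 + e / 20)"
        using K mult_mono[of "3 ^ e" K 1] by simp
      with c3_rainbow_le_crude[OF G] show ?thesis unfolding n_def e_def by linarith
    next
      case False
      define T where "T = 2 powr ((19/20 + \<epsilon>) * real n ^ 2 / 2 + e / 20)"
      \<comment> \<open>Linear in \<open>n\<close>, so that \<open>(39/40) ^ s\<close> beats
        \<open>n ^ 2\<close>, but with a slope so small that \<open>3 ^ (s * n)\<close> stays below
        \<open>2 powr (\<epsilon> * n ^ 2 / 4)\<close>.\<close>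
      define s where "s = nat \<lfloor>\<epsilon> * real n / 8\<rfloor>"
      \<comment> \<open>Keeping \<open>e\<close> instead of the smaller edge count makes
        \<open>M\<close> uniform over all removed pairs.\<close>
      define M where "M = K * 2 powr ((19/20 + \<epsilon>) * (real n - 2) ^ 2 / 2 + e / 20)"
      have N1: "real n ^ 2 * exp (- (\<epsilon> * real n / 8 - 1) / 40) < 1"
        and N2: "real n ^ 2 * 3 * (7/2) ^ n \<le> 1/2 * 2 powr ((19/20) * (2 * real n - 2))"
        and N3: "real n + \<epsilon> * real n ^ 2 / 4 + 1 \<le> \<epsilon> * real n ^ 2 / 2" and n: "n > 0"
        using N[of n] False by auto
      have s_up: "real s \<le> \<epsilon> * real n / 8" and s_low: "\<epsilon> * real n / 8 - 1 \<le> real s"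
        using assms of_int_floor_le[of "\<epsilon> * real n / 8"] real_of_int_floor_gt_diff_one[of "\<epsilon> * real n / 8"]
        unfolding s_def by (simp_all add: less_imp_le del: of_int_floor_le)
      have "(39/40::real) ^ s \<le> exp (-1/40) ^ s"
        using exp_ge_add_one_self[of "-1/40"] by (intro power_mono) auto
      also have "\<dots> = exp (- real s / 40)" by (simp flip: exp_of_nat_mult)
      also have "\<dots> \<le> exp (- (\<epsilon> * real n / 8 - 1) / 40)"
        using s_low by simp
      finally have "real n ^ 2 * (39/40) ^ s \<le> real n ^ 2 * exp (- (\<epsilon> * real n / 8 - 1) / 40)"
        by (intro mult_left_mono) auto
      with N1 have s: "real (card V) ^ 2 * (39/40) ^ s < 1" by (simp add: n_def)
      have M: "real (c3_rainbow (V - {u, v}) {e \<in> E. u \<notin> e \<and> v \<notin> e}) \<le> M"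
        if uv: "u \<in> V" "v \<in> V" "u \<noteq> v" for u v
      proof -
        have fin: "finite V" "finite E" using simple_graph_finite[OF G] by auto
        have c2: "card (V - {u, v}) = n - 2" using uv fin by (simp add: n_def card_Diff_subset)
        have "card {u, v} \<le> n" unfolding n_def using uv fin by (intro card_mono) auto
        \<comment> \<open>With two distinct vertices present, the natural difference
          \<open>n - 2\<close> agrees with the real one in \<open>M\<close>.\<close>
        then have n2: "n \<ge> 2" using uv by simp
        have G': "simple_graph (V - {u, v}) {e \<in> E. u \<notin> e \<and> v \<notin> e}"
          using G unfolding simple_graph_def by fastforce
        have "card {e \<in> E. u \<notin> e \<and> v \<notin> e} \<le> e"
          unfolding e_def using fin by (intro card_mono) auto
        then have "K * 2 powr ((19/20 + \<epsilon>) * real (card (V - {u, v})) ^ 2 / 2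
            + card {e \<in> E. u \<notin> e \<and> v \<notin> e} / 20) \<le> M"
          unfolding M_def c2 using n2 K by (intro mult_left_mono powr_mono) (auto simp: of_nat_diff)
        moreover have "card (V - {u, v}) < card V" using c2 n2 by (simp add: n_def)
        ultimately show ?thesis using less.hyps[OF _ G'] by fastforce
      qed
      have "M \<ge> 0" using K by (simp add: M_def)
      have "V \<noteq> {}" using n by (auto simp: n_def)
      have "real n ^ 2 * 3 * (7/2) ^ n * M \<le> 1/2 * 2 powr ((19/20 + \<epsilon>) * (2 * real n - 2)) * M"
      proof (rule mult_right_mono)
        have "2 powr ((19/20) * (2 * real n - 2)) \<le> 2 powr ((19/20 + \<epsilon>) * (2 * real n - 2))"
          using n assms by (intro powr_mono mult_right_mono) auto
        with N2 show "real n ^ 2 * 3 * (7/2) ^ n \<le> 1/2 * 2 powr ((19/20 + \<epsilon>) * (2 * real n - 2))"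
          by linarith
      qed fact
      also have "\<dots> = 1/2 * K * (2 powr ((19/20 + \<epsilon>) * (2 * real n - 2))
          * 2 powr ((19/20 + \<epsilon>) * (real n - 2) ^ 2 / 2 + e / 20))"
        by (simp add: M_def)
      \<comment> \<open>The exponents recombine by
        \<open>(2 * n - 2) + (n - 2) ^ 2 / 2 = n ^ 2 / 2\<close>.\<close>
      also have "\<dots> = 1/2 * K * T"
        unfolding T_def powr_add[symmetric]
        by (intro arg_cong2[where f = "(*)"] arg_cong2[where f = "(powr)"] refl)
          (simp add: power2_eq_square field_simps)
      finally have one: "real n ^ 2 * 3 * (7/2) ^ n * M \<le> 1/2 * K * T" .
      have "(3::real) ^ (s * n) \<le> 4 ^ (s * n)" by (intro power_mono) auto
      also have "(4::real) ^ (s * n) = 2 ^ (2 * (s * n))" by (subst power_mult) simp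
      also have "\<dots> = 2 powr (2 * (real s * real n))"
        using powr_realpow[of 2 "2 * (s * n)"] by simp
      finally have "2 ^ n * 3 ^ (s * n) * 2 ^ e \<le> 2 powr n * 2 powr (2 * (real s * real n)) * 2 powr e"
        by (simp add: powr_realpow)
      also have "\<dots> = 2 powr (n + 2 * (real s * real n) + e)" by (simp add: powr_add)
      also have "\<dots> \<le> 2 powr ((19/20 + \<epsilon>) * real n ^ 2 / 2 + e / 20 - 1)"
      proof (rule powr_mono)
        have "real s * real n \<le> \<epsilon> * real n / 8 * real n" using s_up by (intro mult_right_mono) auto
        then have "2 * (real s * real n) \<le> \<epsilon> * real n ^ 2 / 4" by (simp add: power2_eq_square)
        \<comment> \<open>Only \<open>19/20\<close> of \<open>e\<close> is estimated by
          \<open>n ^ 2 / 2\<close>; the remaining \<open>e / 20\<close> is kept.\<close>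
        with N3 e show "n + 2 * (real s * real n) + e \<le> (19/20 + \<epsilon>) * real n ^ 2 / 2 + e / 20 - 1"
          by (simp add: field_simps)
      qed simp
      also have "\<dots> = 1/2 * T" by (simp add: T_def powr_diff)
      also have "\<dots> \<le> 1/2 * K * T" using K by (simp add: T_def)
      finally have "2 ^ n * 3 ^ (s * n) * 2 ^ e \<le> 1/2 * K * T" .
      with one c3_rainbow_recurrence[OF G \<open>V \<noteq> {}\<close> s M \<open>M \<ge> 0\<close>]
      show ?thesis by (simp add: n_def e_def T_def)
    qed
  qed
  with K that show ?thesis by blast
qed

section \<open>Deduction of the two estimates\<close>

theorem theorem4p4:
  shows "(\<forall>\<delta>::real. \<delta> > 0 \<longrightarrow> (\<exists>n0::nat. \<forall>(V::'a set) E.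
            simple_graph V E \<and> card V > n0 \<longrightarrow>
            real (c3_rainbow V E) \<le> 2 powr ((1 + \<delta>) * real (card V) ^ 2 / 2)))
       \<and> (\<forall>\<xi>::real. \<xi> > 0 \<longrightarrow> (\<exists>n1::nat. \<forall>(V::'a set) E.
            simple_graph V E \<and> card V > n1 \<and> c3_rainbow V E \<ge> 2 ^ (card V choose 2) \<longrightarrow>
            real (card E) \<ge> real (card V choose 2) - \<xi> * real (card V) ^ 2))"
proof (intro conjI allI impI)
  fix \<delta> :: real assume "\<delta> > 0"
  then have "\<delta> / 2 > 0" by simp
  obtain K :: real where K: "K \<ge> 1" "\<And>(V :: 'a set) E. simple_graph V E \<Longrightarrow>
      real (c3_rainbow V E) \<le> K * 2 powr ((19/20 + \<delta> / 2) * real (card V) ^ 2 / 2 + card E / 20)"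
    using c3_rainbow_le[OF \<open>\<delta> / 2 > 0\<close>] by metis
  have "\<forall>\<^sub>F n in sequentially. log 2 K \<le> \<delta> * real n ^ 2 / 4"
    using K(1) \<open>\<delta> > 0\<close> by real_asymp
  then obtain N where N: "\<And>n. n \<ge> N \<Longrightarrow> log 2 K \<le> \<delta> * real n ^ 2 / 4"
    unfolding eventually_sequentially by blast
  show "\<exists>n0::nat. \<forall>(V::'a set) E. simple_graph V E \<and> card V > n0 \<longrightarrow>
      real (c3_rainbow V E) \<le> 2 powr ((1 + \<delta>) * real (card V) ^ 2 / 2)"
  proof (intro exI[of _ N] allI impI)
    fix V :: "'a set" and E assume *: "simple_graph V E \<and> card V > N"
    have "real (c3_rainbow V E) \<le> K * 2 powr ((19/20 + \<delta> / 2) * real (card V) ^ 2 / 2 + card E / 20)"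
      using K(2) * by blast
    also have "\<dots> = 2 powr (log 2 K + ((19/20 + \<delta> / 2) * real (card V) ^ 2 / 2 + card E / 20))"
      using K(1) by (subst powr_add) simp
    also have "\<dots> \<le> 2 powr ((1 + \<delta>) * real (card V) ^ 2 / 2)"
    proof (rule powr_mono)
      have "log 2 K \<le> \<delta> * real (card V) ^ 2 / 4" "real (card E) \<le> real (card V) ^ 2 / 2"
        using N[of "card V"] card_edges_le[of V E] * by auto
      then show "log 2 K + ((19/20 + \<delta> / 2) * real (card V) ^ 2 / 2 + card E / 20)
          \<le> (1 + \<delta>) * real (card V) ^ 2 / 2"
        by (simp add: field_simps)
    qed simp
    finally show "real (c3_rainbow V E) \<le> 2 powr ((1 + \<delta>) * real (card V) ^ 2 / 2)" .
  qed
next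
  fix \<xi> :: real assume "\<xi> > 0"
  \<comment> \<open>Solving for \<open>card E\<close> multiplies the inequality by 20, so this
    choice yields an error \<open>\<xi> * n ^ 2 / 2\<close>. The other half of the allowance covers
    \<open>20 * log 2 K\<close> and the \<open>19 * n / 2\<close> by which 19 copies of
    \<open>n choose 2\<close> fall short of \<open>19 * n ^ 2 / 2\<close>.\<close>
  then have "\<xi> / 20 > 0" by simp
  obtain K :: real where K: "K \<ge> 1" "\<And>(V :: 'a set) E. simple_graph V E \<Longrightarrow>
      real (c3_rainbow V E) \<le> K * 2 powr ((19/20 + \<xi> / 20) * real (card V) ^ 2 / 2 + card E / 20)"
    using c3_rainbow_le[OF \<open>\<xi> / 20 > 0\<close>] by metis
  have "\<forall>\<^sub>F n in sequentially. 20 * log 2 K + 19 * real n / 2 \<le> \<xi> * real n ^ 2 / 2"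
    using K(1) \<open>\<xi> > 0\<close> by real_asymp
  then obtain N where N: "\<And>n. n \<ge> N \<Longrightarrow> 20 * log 2 K + 19 * real n / 2 \<le> \<xi> * real n ^ 2 / 2"
    unfolding eventually_sequentially by blast
  show "\<exists>n1::nat. \<forall>(V::'a set) E.
      simple_graph V E \<and> card V > n1 \<and> c3_rainbow V E \<ge> 2 ^ (card V choose 2) \<longrightarrow>
      real (card E) \<ge> real (card V choose 2) - \<xi> * real (card V) ^ 2"
  proof (intro exI[of _ N] allI impI)
    fix V :: "'a set" and E
    assume *: "simple_graph V E \<and> card V > N \<and> c3_rainbow V E \<ge> 2 ^ (card V choose 2)"
    have "2 powr real (card V choose 2) = real (2 ^ (card V choose 2))"
      by (simp add: powr_realpow)
    also have "\<dots> \<le> real (c3_rainbow V E)" using * by (intro of_nat_mono) blast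
    also have "\<dots> \<le> K * 2 powr ((19/20 + \<xi> / 20) * real (card V) ^ 2 / 2 + card E / 20)"
      using K(2) * by blast
    also have "\<dots> = 2 powr (log 2 K + ((19/20 + \<xi> / 20) * real (card V) ^ 2 / 2 + card E / 20))"
      using K(1) by (subst powr_add) simp
    finally have "real (card V choose 2)
        \<le> log 2 K + ((19/20 + \<xi> / 20) * real (card V) ^ 2 / 2 + card E / 20)" by simp
    then show "real (card E) \<ge> real (card V choose 2) - \<xi> * real (card V) ^ 2"
      using N[of "card V"] * unfolding real_choose_two
      by (simp add: power2_eq_square field_simps)
  qed
qed

end
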